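(* Let $k \leq 6$ and let $G$ be a finite simple undirected graph that admits a Kempe-coloring of size $k$. Then $h(G) \geq k$.
   Context: An anticlique of $G$ is a set of pairwise nonadjacent vertices. A coloring of $G$ is a partition of $V(G)$ into (nonempty) anticliques; its size is the number of classes. A coloring $\mathfrak{C}$ of $G$ is a Kempe-coloring if for any two distinct members $A,B \in \mathfrak{C}$ the induced subgraph $G[A \cup B]$ is connected. A subset of $V(G)$ is connected if it induces a connected subgraph; two subsets of $V(G)$ are adjacent if some edge of $G$ has one end in each. A clique minor of $G$ is a set of pairwise disjoint, pairwise adjacent, connected, nonempty subsets of $V(G)$. $h(G)$ denotes the largest $k$ such that $G$ has a clique minor of size $k$. *)

theory Defs
  imports "Graph_Theory.Digraph_Component" "HOL-Library.Disjoint_Sets"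
begin

text \<open>
  Finite simple undirected graphs are the instances of the locale \<^locale>\<open>graph\<close>: finite,
  loop-free, symmetric digraphs without parallel arcs, an undirected edge being a pair of
  opposite arcs. The null graph is allowed, but \<^const>\<open>connected\<close> implies a nonempty vertex set.
\<close>

definition anticlique :: "('a, 'b) pre_digraph \<Rightarrow> 'a set \<Rightarrow> bool" where
  "anticlique G A \<longleftrightarrow> A \<subseteq> verts G \<and> pairwise (\<lambda>u v. \<not> u \<rightarrow>\<^bsub>G\<^esub> v) A"

definition coloring :: "('a, 'b) pre_digraph \<Rightarrow> 'a set set \<Rightarrow> bool" where
  "coloring G C \<longleftrightarrow> partition_on (verts G) C \<and> (\<forall>A\<in>C. anticlique G A)"

definition kempe_coloring :: "('a, 'b) pre_digraph \<Rightarrow> 'a set set \<Rightarrow> bool" where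
  "kempe_coloring G C \<longleftrightarrow>
     coloring G C \<and> (\<forall>A\<in>C. \<forall>B\<in>C. A \<noteq> B \<longrightarrow> connected (G \<restriction> (A \<union> B)))"

text \<open>
  The operation \<open>\<restriction>\<close> does not intersect with the vertex set of \<open>G\<close>, so the inclusion is required.
\<close>

definition connected_set :: "('a, 'b) pre_digraph \<Rightarrow> 'a set \<Rightarrow> bool" where
  "connected_set G A \<longleftrightarrow> A \<subseteq> verts G \<and> connected (G \<restriction> A)"

definition adjacent_sets :: "('a, 'b) pre_digraph \<Rightarrow> 'a set \<Rightarrow> 'a set \<Rightarrow> bool" where
  "adjacent_sets G A B \<longleftrightarrow> (\<exists>u\<in>A. \<exists>v\<in>B. u \<rightarrow>\<^bsub>G\<^esub> v)"

definition clique_minor :: "('a, 'b) pre_digraph \<Rightarrow> 'a set set \<Rightarrow> bool" where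
  "clique_minor G M \<longleftrightarrow>
     (\<forall>A\<in>M. A \<noteq> {} \<and> connected_set G A) \<and>
     pairwise disjnt M \<and> pairwise (adjacent_sets G) M"

definition hadwiger_number :: "('a, 'b) pre_digraph \<Rightarrow> nat" where
  "hadwiger_number G = Max {card M | M. clique_minor G M}"

text \<open>For finite graphs the maximum ranges over a finite nonempty set.\<close>

lemma (in graph) finite_clique_minor_sizes:
  "finite {card M | M. clique_minor G M}" "{card M | M. clique_minor G M} \<noteq> {}"
proof -
  have "{M. clique_minor G M} \<subseteq> Pow (Pow (verts G))"
    by (auto simp: clique_minor_def connected_set_def)
  then have "finite {M. clique_minor G M}"
    by (rule finite_subset) simp
  then show "finite {card M | M. clique_minor G M}"
    by simp
  have "clique_minor G {}"
    by (simp add: clique_minor_def)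
  then show "{card M | M. clique_minor G M} \<noteq> {}"
    by blast
qed

end

theory Submission
  imports Defs
begin

text \<open>
  If a coloring \<open>C\<close> of size \<open>k\<close> on \<open>n\<close> vertices is a Kempe-coloring, any two classes \<open>A\<close>, \<open>B\<close> span
  at least \<open>|A| + |B| - 1\<close> edges, so there are at least \<open>(k - 1) n - k (k - 1) / 2\<close> edges in total.
  For \<open>k \<le> 6\<close> this many edges force a clique minor of size \<open>k\<close>, by Mader's argument: consider a
  density condition of the form \<open>e \<ge> a n - b\<close> which \<open>n = k\<close> forces to be a complete graph. If no
  deletion or contraction preserves it, then every edge lies in at least \<open>a\<close> triangles and some
  vertex has degree at most \<open>2 a - 1\<close>. Its neighbourhood is a small graph of minimum degree at least
  \<open>a\<close>, hence dense enough for a clique minor of size \<open>k - 1\<close>. The pairs \<open>(a, b)\<close> for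
  \<open>k = 2, \<dots>, 6\<close> are \<open>(1, 1)\<close>, \<open>(2, 3)\<close>, \<open>(2, 2)\<close>, \<open>(3, 5)\<close>, \<open>(5, 15)\<close>.

  Graphs are handled as symmetric relations, so that every edge is counted twice.
\<close>

section \<open>Symmetric relations as graphs, and their clique minors\<close>

definition simple_graph :: "'a set \<Rightarrow> 'a rel \<Rightarrow> bool" where
  "simple_graph V R \<longleftrightarrow> finite V \<and> R \<subseteq> V \<times> V \<and> sym R \<and> irrefl R"

text \<open>Connectedness by cuts rather than paths: this form is preserved by undoing a contraction.\<close>

definition conn :: "'a rel \<Rightarrow> 'a set \<Rightarrow> bool" where
  "conn R S \<longleftrightarrow> S \<noteq> {} \<and> (\<forall>A. A \<noteq> {} \<longrightarrow> A \<subset> S \<longrightarrow> (\<exists>x\<in>A. \<exists>y\<in>S - A. (x, y) \<in> R))"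

definition adj :: "'a rel \<Rightarrow> 'a set \<Rightarrow> 'a set \<Rightarrow> bool" where
  "adj R A B \<longleftrightarrow> (\<exists>x\<in>A. \<exists>y\<in>B. (x, y) \<in> R)"

definition has_clique_minor :: "'a set \<Rightarrow> 'a rel \<Rightarrow> nat \<Rightarrow> bool" where
  "has_clique_minor V R k \<longleftrightarrow> (\<exists>M. finite M \<and> card M = k \<and> (\<forall>S\<in>M. S \<subseteq> V \<and> conn R S) \<and>
     pairwise disjnt M \<and> pairwise (adj R) M)"

definition del_vertex :: "'a rel \<Rightarrow> 'a \<Rightarrow> 'a rel" where
  "del_vertex R v = {(x, y) \<in> R. x \<noteq> v \<and> y \<noteq> v}"

text \<open>The contraction of the edge \<open>u v\<close> keeps the name \<open>u\<close> for the new vertex.\<close>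

definition contract :: "'a rel \<Rightarrow> 'a \<Rightarrow> 'a \<Rightarrow> 'a rel" where
  "contract R u v = (let N = R `` {v} - {u} - R `` {u} in del_vertex R v \<union> {u} \<times> N \<union> N \<times> {u})"

lemma conn_mono: "conn R S \<Longrightarrow> R \<subseteq> R' \<Longrightarrow> conn R' S"
  unfolding conn_def by (meson subsetD)

lemma conn_singleton: "conn R {x}"
  unfolding conn_def by (simp add: psubset_eq subset_singleton_iff)

lemma has_clique_minor_mono:
  assumes "has_clique_minor V R k" "V \<subseteq> V'" "R \<subseteq> R'"
  shows "has_clique_minor V' R' k"
proof -
  from assms(1) obtain M where M: "finite M" "card M = k" "\<forall>S\<in>M. S \<subseteq> V \<and> conn R S"
    "pairwise disjnt M" "pairwise (adj R) M"
    unfolding has_clique_minor_def by blast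
  have "pairwise (adj R') M"
    using M(5) assms(3) unfolding adj_def pairwise_def by blast
  with M assms(2,3) conn_mono show ?thesis
    unfolding has_clique_minor_def by (intro exI[of _ M]) blast
qed

text \<open>The singleton \<open>{v}\<close> joins as one more branch set: every other branch set is
  nonempty and lies in \<open>N\<close>, hence is adjacent to it. In the application
  \<open>N\<close> is the neighbourhood of \<open>v\<close>.\<close>

lemma has_clique_minor_insert_dominating:
  assumes "has_clique_minor N R k" "v \<notin> N" "v \<in> V" "N \<subseteq> V" and dom: "\<forall>x\<in>N. (v, x) \<in> R \<and> (x, v) \<in> R"
  shows "has_clique_minor V R (Suc k)"
proof -
  from assms(1) obtain M where M: "finite M" "card M = k" "\<forall>S\<in>M. S \<subseteq> N \<and> conn R S"
    "pairwise disjnt M" "pairwise (adj R) M"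
    unfolding has_clique_minor_def by blast
  have ne: "\<forall>S\<in>M. S \<noteq> {}" using M(3) conn_def by metis
  have "{v} \<notin> M" using M(3) assms(2) by blast
  then have "card (insert {v} M) = Suc k" using M by simp
  moreover have "pairwise disjnt (insert {v} M)"
    using M(3,4) assms(2) by (auto simp: pairwise_insert disjnt_def)
  moreover have "adj R {v} S \<and> adj R S {v}" if S: "S \<in> M" for S
  proof -
    obtain x where "x \<in> S" "x \<in> N" using ne M(3) S by blast
    then show ?thesis using dom by (auto simp: adj_def)
  qed
  then have "pairwise (adj R) (insert {v} M)"
    using M(5) by (auto simp: pairwise_insert)
  ultimately show ?thesis
    using M(1,3) assms(3,4) conn_singleton unfolding has_clique_minor_def
    by (intro exI[of _ "insert {v} M"]) auto
qed

section \<open>Arc counts: degrees, vertex deletion, edge contraction\<close>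

lemma sum_degrees:
  assumes "simple_graph V R"
  shows "(\<Sum>v\<in>V. card (R `` {v})) = card R"
proof -
  have fin: "finite V" "R \<subseteq> V \<times> V" using assms by (auto simp: simple_graph_def)
  then have "finite R" by (meson finite_SigmaI finite_subset)
  then have "\<forall>v\<in>V. finite (R `` {v})" by (simp add: finite_Image)
  moreover have "R = Sigma V (\<lambda>v. R `` {v})" using fin by auto
  ultimately show ?thesis using fin(1) card_SigmaI by metis
qed

lemma simple_graph_finite: "simple_graph V R \<Longrightarrow> finite R"
  unfolding simple_graph_def by (meson finite_SigmaI finite_subset)

lemma simple_graph_del_vertex:
  "simple_graph V R \<Longrightarrow> simple_graph (V - {v}) (del_vertex R v)"
  unfolding simple_graph_def del_vertex_def sym_def irrefl_def by auto

lemma card_del_vertex: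
  assumes "simple_graph V R"
  shows "card R = card (del_vertex R v) + 2 * card (R `` {v})"
proof -
  let ?N = "R `` {v}"
  have fin: "finite R" using assms by (rule simple_graph_finite)
  then have finN: "finite ?N" by (rule finite_Image)
  have s: "sym R" "irrefl R" using assms by (auto simp: simple_graph_def)
  have "v \<notin> ?N" using s by (auto simp: irrefl_def)
  then have "card ({v} \<times> ?N \<union> ?N \<times> {v}) = 2 * card ?N"
    using finN by (subst card_Un_disjoint) (auto simp: card_cartesian_product)
  moreover have "R = del_vertex R v \<union> ({v} \<times> ?N \<union> ?N \<times> {v})"
    using s by (auto simp: del_vertex_def sym_def)
  moreover have "del_vertex R v \<inter> ({v} \<times> ?N \<union> ?N \<times> {v}) = {}"
    by (auto simp: del_vertex_def)
  moreover have "finite (del_vertex R v)"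
    using fin by (rule rev_finite_subset) (auto simp: del_vertex_def)
  ultimately show ?thesis
    using finN card_Un_disjoint[of "del_vertex R v" "{v} \<times> ?N \<union> ?N \<times> {v}"] by simp
qed

text \<open>Deleting a vertex removes an even number of arcs, so parity descends to the empty
  graph.\<close>

lemma even_card_simple_graph:
  "simple_graph V R \<Longrightarrow> even (card R)"
proof (induction "card V" arbitrary: V R)
  case 0
  then have "R = {}" by (auto simp: simple_graph_def)
  then show ?case by simp
next
  case (Suc n)
  then obtain v where "v \<in> V" by fastforce
  then have "card (V - {v}) = n" using Suc.hyps(2) by simp
  then have "even (card (del_vertex R v))"
    using Suc.hyps(1)[of "V - {v}"] simple_graph_del_vertex[OF Suc.prems] by simp
  then show ?case using card_del_vertex[OF Suc.prems, of v] by simp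
qed

lemma simple_graph_contract:
  assumes "simple_graph V R" "(u, v) \<in> R"
  shows "simple_graph (V - {v}) (contract R u v)"
proof -
  define N where "N = R `` {v} - {u} - R `` {u}"
  have c: "contract R u v = del_vertex R v \<union> ({u} \<times> N \<union> N \<times> {u})"
    by (simp add: contract_def Let_def N_def Un_assoc)
  have g: "simple_graph (V - {v}) (del_vertex R v)"
    using assms(1) by (rule simple_graph_del_vertex)
  have "R \<subseteq> V \<times> V" "irrefl R" using assms(1) by (auto simp: simple_graph_def)
  then have N: "N \<subseteq> V - {v}" "u \<notin> N" "u \<in> V - {v}"
    using assms(2) by (auto simp: N_def irrefl_def)
  have "contract R u v \<subseteq> (V - {v}) \<times> (V - {v})"
    using g N unfolding c simple_graph_def by blast
  moreover have "sym (contract R u v)"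
    using g unfolding c simple_graph_def sym_def by blast
  moreover have "irrefl (contract R u v)"
    using g N unfolding c simple_graph_def irrefl_def by blast
  ultimately show ?thesis using g by (simp add: simple_graph_def)
qed

text \<open>Contraction loses the edge \<open>u v\<close> itself and, for each common neighbour of
  \<open>u\<close> and \<open>v\<close>, one of two edges that become parallel. So the loss is one
  more than the number of triangles on the edge.\<close>

lemma card_contract:
  assumes g: "simple_graph V R" and uv: "(u, v) \<in> R"
  shows "card R = card (contract R u v) + 2 * Suc (card (R `` {u} \<inter> R `` {v}))"
proof -
  let ?N = "R `` {v} - {u} - R `` {u}"
  have fin: "finite R" using g by (rule simple_graph_finite)
  then have finv: "finite (R `` {v})" by (rule finite_Image)
  have s: "sym R" "irrefl R" using g by (auto simp: simple_graph_def)
  have "u \<in> R `` {v}" "u \<notin> R `` {u}" using s uv by (auto simp: sym_def irrefl_def)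
  then have "R `` {v} = insert u (?N \<union> (R `` {u} \<inter> R `` {v}))" by auto
  moreover have "u \<notin> ?N \<union> (R `` {u} \<inter> R `` {v})" using s by (auto simp: irrefl_def)
  moreover have "card (?N \<union> (R `` {u} \<inter> R `` {v})) = card ?N + card (R `` {u} \<inter> R `` {v})"
    using finv by (intro card_Un_disjoint) auto
  ultimately have deg: "card (R `` {v}) = Suc (card ?N + card (R `` {u} \<inter> R `` {v}))"
    using finv by (metis card_insert_disjoint finite_Un finite_insert)
  have "card ({u} \<times> ?N \<union> ?N \<times> {u}) = 2 * card ?N"
    using finv by (subst card_Un_disjoint) (auto simp: card_cartesian_product)
  moreover have "finite (del_vertex R v)"
    using fin by (rule rev_finite_subset) (auto simp: del_vertex_def)
  moreover have "del_vertex R v \<inter> ({u} \<times> ?N \<union> ?N \<times> {u}) = {}"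
    using s by (auto simp: del_vertex_def sym_def)
  ultimately have "card (contract R u v) = card (del_vertex R v) + 2 * card ?N"
    using finv card_Un_disjoint[of "del_vertex R v" "{u} \<times> ?N \<union> ?N \<times> {u}"]
    by (simp add: contract_def Let_def Un_assoc)
  then show ?thesis using card_del_vertex[OF g, of v] deg by simp
qed

section \<open>Clique minors from contractions and from complete graphs\<close>

text \<open>Adding \<open>v\<close> to the branch set that contains \<open>u\<close>, if there is
  one, undoes the contraction. An arc of the contraction is an arc of \<open>R\<close>, up to
  replacing \<open>u\<close> by \<open>v\<close> at one end.\<close>

lemma has_clique_minor_contract:
  assumes g: "simple_graph V R" and uv: "(u, v) \<in> R"
    and minor: "has_clique_minor (V - {v}) (contract R u v) k"
  shows "has_clique_minor V R k"
proof -
  from minor obtain M where M: "finite M" "card M = k"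
    "\<forall>S\<in>M. S \<subseteq> V - {v} \<and> conn (contract R u v) S"
    "pairwise disjnt M" "pairwise (adj (contract R u v)) M"
    unfolding has_clique_minor_def by blast
  have s: "sym R" "u \<in> V" "v \<in> V" "(v, u) \<in> R" "u \<noteq> v"
    using g uv by (auto simp: simple_graph_def sym_def irrefl_def)
  define f where "f S = (if u \<in> S then insert v S else S)" for S
  have contr: "(x, y) \<in> R \<or> (x = u \<and> (v, y) \<in> R) \<or> (y = u \<and> (x, v) \<in> R)"
    if "(x, y) \<in> contract R u v" for x y
    using that s by (auto simp: contract_def Let_def del_vertex_def sym_def)
  have inj: "inj_on f M"
  proof (rule inj_onI)
    fix S T assume "S \<in> M" "T \<in> M" "f S = f T"
    moreover have "f S - {v} = S" if "S \<in> M" for S using that M(3) by (auto simp: f_def)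
    ultimately show "S = T" by metis
  qed
  have conn_f: "conn R (f S)" if S: "S \<in> M" for S
    unfolding conn_def
  proof (intro conjI allI impI)
    have cS: "conn (contract R u v) S" and vS: "v \<notin> S" using M(3) S by auto
    then show "f S \<noteq> {}" by (auto simp: f_def conn_def)
    fix A assume A: "A \<noteq> {}" "A \<subset> f S"
    show "\<exists>x\<in>A. \<exists>y\<in>f S - A. (x, y) \<in> R"
    \<comment> \<open>If \<open>A\<close> separates \<open>u\<close> from \<open>v\<close>, the edge
      \<open>u v\<close> crosses the cut. Otherwise \<open>A - {v}\<close> is a cut of
      \<open>S\<close>; an arc of the contraction crossing it lifts to an arc of \<open>R\<close>
      crossing \<open>A\<close>, since \<open>u\<close> and \<open>v\<close>, when both in
      \<open>f S\<close>, are on the same side.\<close>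
    proof (cases "u \<in> S \<and> (u \<in> A \<longleftrightarrow> v \<notin> A)")
      case True
      then show ?thesis using s(4) uv by (auto simp: f_def)
    next
      case False
      have "A - {v} \<noteq> {}" using A False vS s(5) by (auto simp: f_def split: if_splits)
      moreover have "A - {v} \<subset> S" using A False vS by (auto simp: f_def split: if_splits)
      ultimately obtain x y where xy: "x \<in> A - {v}" "y \<in> S - (A - {v})" "(x, y) \<in> contract R u v"
        using cS unfolding conn_def by meson
      then show ?thesis using contr[OF xy(3)] False vS A(2)
        by (auto simp: f_def split: if_splits)
    qed
  qed
  have "adj R (f S) (f T)" if ST: "S \<in> M" "T \<in> M" "S \<noteq> T" for S T
  proof -
    obtain x y where xy: "x \<in> S" "y \<in> T" "(x, y) \<in> contract R u v"
      using M(5) ST unfolding pairwise_def adj_def by blast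
    then show ?thesis using contr[OF xy(3)] by (auto simp: f_def adj_def)
  qed
  then have adj_f: "pairwise (adj R) (f ` M)" by (auto simp: pairwise_def)
  have "disjnt (f S) (f T)" if ST: "S \<in> M" "T \<in> M" "S \<noteq> T" for S T
  proof -
    have "disjnt S T" "v \<notin> S" "v \<notin> T" using M(3,4) ST by (auto simp: pairwise_def)
    then show ?thesis by (auto simp: f_def disjnt_def)
  qed
  then have "pairwise disjnt (f ` M)" by (auto simp: pairwise_def)
  moreover have "\<forall>S\<in>f ` M. S \<subseteq> V \<and> conn R S"
    using M(3) conn_f s(3) unfolding f_def by (smt (verit) Diff_subset image_iff insert_subset subset_trans)
  moreover have "card (f ` M) = k" using inj M(2) by (simp add: card_image)
  ultimately show ?thesis using M(1) adj_f unfolding has_clique_minor_def by blast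
qed

text \<open>Only the complete graph has that many arcs, and there the singletons form the minor.
  This is the base case of \<open>dense_step\<close>.\<close>

lemma has_clique_minor_complete:
  assumes "simple_graph V R" "card V * (card V - 1) \<le> card R"
  shows "has_clique_minor V R (card V)"
proof -
  have fin: "finite V" and sub: "R \<subseteq> V \<times> V - Id_on V"
    using assms(1) by (auto simp: simple_graph_def irrefl_def)
  have "Id_on V = (\<lambda>x. (x, x)) ` V" by auto
  then have "card (Id_on V) = card V" "finite (Id_on V)"
    using fin by (simp_all add: card_image inj_on_def)
  then have "card (V \<times> V - Id_on V) = card V * card V - card V"
    using fin by (subst card_Diff_subset) (auto simp: card_cartesian_product)
  also have "\<dots> \<le> card R" using assms(2) by (simp add: algebra_simps)
  finally have "R = V \<times> V - Id_on V"
    using sub fin by (intro card_seteq) auto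
  then have "pairwise (adj R) ((\<lambda>x. {x}) ` V)"
    by (auto simp: pairwise_def adj_def)
  moreover have "pairwise disjnt ((\<lambda>x. {x}) ` V)"
    by (auto simp: pairwise_def)
  moreover have "card ((\<lambda>x. {x}) ` V) = card V" by (simp add: card_image)
  moreover have "\<forall>S\<in>(\<lambda>x. {x}) ` V. S \<subseteq> V \<and> conn R S" by (auto simp: conn_singleton)
  ultimately show ?thesis using fin unfolding has_clique_minor_def by blast
qed

section \<open>Mader's induction step\<close>

lemma exists_low_degree:
  assumes "simple_graph V R" "card R < c * card V"
  shows "\<exists>v\<in>V. card (R `` {v}) < c"
proof (rule ccontr)
  assume "\<not> ?thesis"
  then have "(\<Sum>v\<in>V. c) \<le> (\<Sum>v\<in>V. card (R `` {v}))"
    by (intro sum_mono) auto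
  then show False using assms sum_degrees[OF assms(1)] by (simp add: mult.commute)
qed

text \<open>
  The parity of \<open>r\<close> is needed for \<open>k + 1 = 5\<close> and a neighbourhood of \<open>m = 5\<close> vertices, where
  minimum degree 3 gives \<open>r \<ge> 15\<close> but the bound for \<open>k = 4\<close> asks for \<open>r \<ge> 16\<close>.
\<close>

lemma dense_step:
  fixes V :: "'a set"
  assumes small: "\<And>W (Q::'a rel). simple_graph W Q \<Longrightarrow> k \<le> card W \<Longrightarrow>
      2 * a' * card W \<le> card Q + 2 * b' \<Longrightarrow> has_clique_minor W Q k"
    and base: "2 * a * Suc k = 2 * b + Suc k * k" and pos: "0 < b"
    and local: "\<And>m r. a < m \<Longrightarrow> m < 2 * a \<Longrightarrow> even r \<Longrightarrow> a * m \<le> r \<Longrightarrow>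
      k \<le> m \<and> 2 * a' * m \<le> r + 2 * b'"
    and "simple_graph V R" "Suc k \<le> card V" "2 * a * card V \<le> card R + 2 * b"
  shows "has_clique_minor V R (Suc k)"
  using assms(5-)
proof (induction "card V + card R" arbitrary: V R rule: less_induct)
  case less
  note g = less.prems(1)
  have fin: "finite V" "R \<subseteq> V \<times> V" "sym R" "irrefl R" "finite R"
    using g simple_graph_finite[OF g] by (auto simp: simple_graph_def)
  show ?case
  proof (cases "card V = Suc k")
    case True
    \<comment> \<open>By \<open>base\<close>, the density bound for \<open>Suc k\<close> vertices is
      the arc count of the complete graph.\<close>
    then have "card V * (card V - 1) \<le> card R" using less.prems(3) base by simp
    then show ?thesis using has_clique_minor_complete[OF g] True by simp
  next
    case False
    then have big: "Suc k \<le> card V - 1" using less.prems(2) by simp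
    \<comment> \<open>In the first three cases a smaller graph keeps the density condition: an edge
      is to spare, or one vertex goes together with at most \<open>2 * a\<close> arcs.\<close>
    consider (excess) "2 * a * card V + 2 \<le> card R + 2 * b" "R \<noteq> {}"
      | (contract) u v where "(u, v) \<in> R" "card (R `` {u} \<inter> R `` {v}) < a"
      | (delete) v where "v \<in> V" "card (R `` {v}) \<le> a"
      | (rigid) "card R + 2 * b < 2 * a * card V + 2"
          "\<forall>u v. (u, v) \<in> R \<longrightarrow> a \<le> card (R `` {u} \<inter> R `` {v})"
          "\<forall>v\<in>V. a < card (R `` {v})"
    proof -
      \<comment> \<open>Without edges every vertex has degree 0 and falls under
        \<open>delete\<close>.\<close>
      have "\<exists>v\<in>V. card (R `` {v}) \<le> a" if "R = {}"
        using that big by (auto simp: card_gt_0_iff intro!: ex_in_conv[THEN iffD2])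
      then show ?thesis using that by (meson not_le)
    qed
    then show ?thesis
    proof cases
      case excess
      then obtain x y where xy: "(x, y) \<in> R" by auto
      let ?R = "R - {(x, y), (y, x)}"
      have "x \<noteq> y" "(y, x) \<in> R" using xy fin by (auto simp: irrefl_def sym_def)
      then have "card {(x, y), (y, x)} = 2" "{(x, y), (y, x)} \<subseteq> R" using xy by auto
      then have c: "card ?R = card R - 2" "2 \<le> card R"
        using fin card_Diff_subset[of "{(x, y), (y, x)}" R] card_mono[of R "{(x, y), (y, x)}"]
        by simp_all
      have "simple_graph V ?R"
        using g by (auto simp: simple_graph_def sym_def irrefl_def)
      then have "has_clique_minor V ?R (Suc k)"
        using less.hyps[of V ?R] less.prems(2) c excess(1) by simp
      then show ?thesis by (rule has_clique_minor_mono) auto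
    next
      case contract
      let ?R = "contract R u v"
      have vV: "v \<in> V" using contract fin by auto
      then have cV: "card V = Suc (card (V - {v}))" using fin(1) by (metis card_Suc_Diff1)
      note c = card_contract[OF g contract(1)]
      have "has_clique_minor (V - {v}) ?R (Suc k)"
      proof (rule less.hyps)
        show "simple_graph (V - {v}) ?R" using simple_graph_contract[OF g contract(1)] .
        show "2 * a * card (V - {v}) \<le> card ?R + 2 * b"
          using less.prems(3) c contract(2) cV by simp
      qed (use c cV big in auto)
      then show ?thesis by (rule has_clique_minor_contract[OF g contract(1)])
    next
      case delete
      then have cV: "card V = Suc (card (V - {v}))" using fin(1) by (metis card_Suc_Diff1)
      note c = card_del_vertex[OF g, of v]
      have "has_clique_minor (V - {v}) (del_vertex R v) (Suc k)"
      proof (rule less.hyps)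
        show "simple_graph (V - {v}) (del_vertex R v)" using simple_graph_del_vertex[OF g] .
        show "2 * a * card (V - {v}) \<le> card (del_vertex R v) + 2 * b"
          using less.prems(3) c delete(2) cV by simp
      qed (use c cV big in auto)
      then show ?thesis by (rule has_clique_minor_mono) (auto simp: del_vertex_def)
    next
      case rigid
      have "even (card R)" using even_card_simple_graph[OF g] .
      \<comment> \<open>Parity improves the bound to
        \<open>card R + 2 * b \<le> 2 * a * card V\<close>; as \<open>0 < b\<close>, the average
        degree is then strictly below \<open>2 * a\<close>.\<close>
      with rigid(1) pos have "card R < 2 * a * card V" by presburger
      then obtain v where v: "v \<in> V" "card (R `` {v}) < 2 * a"
        using exists_low_degree[OF g] by blast
      define N where "N = R `` {v}"
      define Q where "Q = R \<inter> N \<times> N"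
      have NV: "N \<subseteq> V" using fin by (auto simp: N_def)
      have gQ: "simple_graph N Q"
        using fin NV by (auto simp: Q_def simple_graph_def sym_def irrefl_def finite_subset)
      \<comment> \<open>The edge \<open>v u\<close> lies in at least \<open>a\<close> triangles,
        whose third vertices are the neighbours of \<open>u\<close> inside \<open>N\<close>.\<close>
      have "a \<le> card (Q `` {u})" if u: "u \<in> N" for u
      proof -
        have "(v, u) \<in> R" using u by (simp add: N_def)
        moreover have "R `` {v} \<inter> R `` {u} = Q `` {u}" using u by (auto simp: N_def Q_def)
        ultimately show ?thesis using rigid(2) by metis
      qed
      then have "(\<Sum>u\<in>N. a) \<le> (\<Sum>u\<in>N. card (Q `` {u}))" by (intro sum_mono)
      then have "a * card N \<le> card Q" using sum_degrees[OF gQ] by (simp add: mult.commute)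
      moreover have "a < card N" "card N < 2 * a" using rigid(3) v by (auto simp: N_def)
      ultimately have "k \<le> card N \<and> 2 * a' * card N \<le> card Q + 2 * b'"
        using local even_card_simple_graph[OF gQ] by blast
      then have "has_clique_minor N Q k" using small[OF gQ] by blast
      then have "has_clique_minor N R k" by (rule has_clique_minor_mono) (auto simp: Q_def)
      then show ?thesis
        using fin v(1) NV
        by (rule_tac has_clique_minor_insert_dominating) (auto simp: N_def irrefl_def sym_def)
    qed
  qed
qed

section \<open>Density bounds forcing clique minors of sizes 1 to 6\<close>

lemma K1_minor: "simple_graph V R \<Longrightarrow> 1 \<le> card V \<Longrightarrow> has_clique_minor V R 1"
proof -
  assume "1 \<le> card V"
  then obtain x where "x \<in> V" by fastforce
  then show ?thesis unfolding has_clique_minor_def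
    by (intro exI[of _ "{{x}}"]) (auto simp: conn_singleton)
qed

lemma K2_minor:
  assumes "simple_graph V R" "2 \<le> card V" "2 * card V \<le> card R + 2"
  shows "has_clique_minor V R 2"
proof -
  have "has_clique_minor V R (Suc 1)"
    \<comment> \<open>No \<open>m\<close> satisfies \<open>1 < m < 2\<close>, so
      \<open>local\<close> holds vacuously. With \<open>a' = b' = 0\<close> the density hypothesis
      in \<open>small\<close> is trivial.\<close>
    by (rule dense_step[of 1 0 0 1 1]) (use assms K1_minor in auto)
  then show ?thesis by (simp add: numeral_2_eq_2)
qed

text \<open>Slope \<open>a = 1\<close> would force \<open>b = 0\<close> in \<open>base\<close>,
  which \<open>dense_step\<close> excludes. The pair \<open>(2, 3)\<close> is exactly the Kempe
  count for three classes.\<close>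

lemma K3_minor:
  "simple_graph V R \<Longrightarrow> 3 \<le> card V \<Longrightarrow> 4 * card V \<le> card R + 6 \<Longrightarrow> has_clique_minor V R 3"
  by (rule dense_step[of 2 1 1 2 3 V R, simplified]) (use K2_minor in auto)

text \<open>Only \<open>m = 3\<close> occurs, and 3 vertices with 6 arcs meet the bound of
  \<open>K3_minor\<close> with equality.\<close>

lemma K4_minor:
  "simple_graph V R \<Longrightarrow> 4 \<le> card V \<Longrightarrow> 4 * card V \<le> card R + 4 \<Longrightarrow> has_clique_minor V R 4"
  by (rule dense_step[of 3 2 3 2 2 V R, simplified]) (use K3_minor in auto)

lemma K5_minor:
  "simple_graph V R \<Longrightarrow> 5 \<le> card V \<Longrightarrow> 6 * card V \<le> card R + 10 \<Longrightarrow> has_clique_minor V R 5"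
  by (rule dense_step[of 4 2 2 3 5 V R, simplified]) (use K4_minor in auto, presburger)

text \<open>The bound \<open>6 * m \<le> r + 10\<close> for neighbourhoods follows from
  \<open>5 * m \<le> r\<close> and \<open>m < 10\<close>. With slope 4 it could fail at
  \<open>m = 6\<close>; slope 5 is what the Kempe count for six classes provides.\<close>

lemma K6_minor:
  "simple_graph V R \<Longrightarrow> 6 \<le> card V \<Longrightarrow> 10 * card V \<le> card R + 30 \<Longrightarrow> has_clique_minor V R 6"
  by (rule dense_step[of 5 3 5 5 15 V R, simplified]) (use K5_minor in auto)

section \<open>Edges in connected sets, and transfer to the locale \<open>graph\<close>\<close>

text \<open>A spanning tree is grown vertex by vertex: as long as \<open>T\<close> is a proper part
  of \<open>S\<close>, the cut around \<open>T\<close> supplies an edge, hence two arcs, to a new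
  vertex.\<close>

lemma conn_card_bound:
  assumes "finite S" "conn R S" "sym R"
  shows "2 * card S \<le> card (R \<inter> S \<times> S) + 2"
proof -
  have "\<exists>T\<subseteq>S. card T = Suc n \<and> 2 * n \<le> card (R \<inter> T \<times> T)" if "Suc n \<le> card S" for n
    using that
  proof (induction n)
    case 0
    then obtain x where "x \<in> S" by fastforce
    then show ?case by (intro exI[of _ "{x}"]) auto
  next
    case (Suc n)
    then obtain T where T: "T \<subseteq> S" "card T = Suc n" "2 * n \<le> card (R \<inter> T \<times> T)" by auto
    have "T \<noteq> {}" "T \<subset> S" using T Suc.prems by auto
    then obtain x y where xy: "x \<in> T" "y \<in> S - T" "(x, y) \<in> R"
      using assms(2) unfolding conn_def by meson
    have finT: "finite T" using T(1) assms(1) finite_subset by blast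
    have "x \<noteq> y" using xy by blast
    have "2 * Suc n \<le> 2 + card (R \<inter> T \<times> T)" using T(3) by simp
    also have "\<dots> = card ({(x, y), (y, x)} \<union> R \<inter> T \<times> T)"
      using \<open>x \<noteq> y\<close> xy finT by (subst card_Un_disjoint) auto
    also have "\<dots> \<le> card (R \<inter> insert y T \<times> insert y T)"
      using xy finT assms(3) by (intro card_mono) (auto simp: sym_def)
    finally have "2 * Suc n \<le> card (R \<inter> insert y T \<times> insert y T)" .
    moreover have "insert y T \<subseteq> S" "card (insert y T) = Suc (Suc n)" using T xy finT by auto
    ultimately show ?case by blast
  qed
  moreover have pos: "0 < card S" using assms(1,2) by (auto simp: conn_def card_gt_0_iff)
  ultimately obtain T where T: "T \<subseteq> S" "card T = card S" "2 * (card S - 1) \<le> card (R \<inter> T \<times> T)"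
    by (metis Suc_diff_1 order_refl)
  have "T = S" using card_subset_eq[OF assms(1) T(1,2)] .
  then have "2 * (card S - 1) + 2 \<le> card (R \<inter> S \<times> S) + 2" using T(3) by simp
  moreover have "2 * card S = 2 * (card S - 1) + 2" using pos by simp
  ultimately show ?thesis by simp
qed

lemma arcs_ends_induce: "arcs_ends (G \<restriction> S) = arcs_ends G \<inter> S \<times> S"
  by (auto simp: arcs_ends_conv)

text \<open>A set that no arc leaves contains everything reachable from its members. Conversely, the
  set reachable from \<open>u\<close> is left by no arc within \<open>S\<close>, so it is not a
  proper part of \<open>S\<close>. Symmetry identifies \<open>?Q\<close> with the symmetric closure
  behind \<open>connected\<close>.\<close>

lemma connected_iff_conn:
  assumes "sym (arcs_ends G)"
  shows "connected (G \<restriction> S) \<longleftrightarrow> conn (arcs_ends G) S"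
proof -
  let ?Q = "arcs_ends G \<inter> S \<times> S"
  have "symcl ?Q = ?Q" using assms by (auto simp: symcl_def sym_def)
  then have c: "connected (G \<restriction> S) \<longleftrightarrow> S \<noteq> {} \<and> (\<forall>u\<in>S. \<forall>v\<in>S. (u, v) \<in> rtrancl_on S ?Q)"
    unfolding connected_conv arcs_ends_induce by simp
  have out: "\<exists>x\<in>A. \<exists>y\<in>S - A. (x, y) \<in> arcs_ends G"
    if all: "\<forall>u\<in>S. \<forall>v\<in>S. (u, v) \<in> rtrancl_on S ?Q" and A: "A \<noteq> {}" "A \<subset> S" for A
  proof (rule ccontr)
    assume closed: "\<not> ?thesis"
    obtain u v where uv: "u \<in> A" "v \<in> S - A" using A by blast
    then have "(u, v) \<in> rtrancl_on S ?Q" using all A by blast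
    then have "v \<in> A" using closed uv(1) by (induction rule: rtrancl_on_induct) auto
    then show False using uv by simp
  qed
  have reach: "(u, v) \<in> rtrancl_on S ?Q" if con: "conn (arcs_ends G) S" and uv: "u \<in> S" "v \<in> S" for u v
  proof (rule ccontr)
    let ?A = "{w. (u, w) \<in> rtrancl_on S ?Q}"
    assume "(u, v) \<notin> rtrancl_on S ?Q"
    then have "?A \<noteq> {}" "?A \<subset> S" using uv by (auto dest: in_rtrancl_on_in_F)
    then obtain x y where xy: "x \<in> ?A" "y \<in> S - ?A" "(x, y) \<in> arcs_ends G"
      using con unfolding conn_def by meson
    then have "x \<in> S" by (auto dest: in_rtrancl_on_in_F)
    then have "(u, y) \<in> rtrancl_on S ?Q"
      using xy by (auto intro: rtrancl_on_into_rtrancl_on)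
    then show False using xy by simp
  qed
  show ?thesis unfolding c using out reach by (auto simp: conn_def)
qed

lemma (in graph) simple_graph_arcs_ends: "simple_graph (verts G) (arcs_ends G)"
  using sym_arcs adj_not_same
  by (auto simp: simple_graph_def symmetric_def irrefl_def dest: adj_in_verts)

lemma (in graph) hadwiger_number_ge:
  assumes "has_clique_minor (verts G) (arcs_ends G) k"
  shows "k \<le> hadwiger_number G"
proof -
  have s: "sym (arcs_ends G)" using sym_arcs by (simp add: symmetric_def)
  obtain M where M: "card M = k" "\<forall>S\<in>M. S \<subseteq> verts G \<and> conn (arcs_ends G) S"
      "pairwise disjnt M" "pairwise (adj (arcs_ends G)) M"
    using assms unfolding has_clique_minor_def by blast
  have "clique_minor G M"
    using M(2-) unfolding clique_minor_def connected_set_def connected_iff_conn[OF s]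
    by (auto simp: conn_def adjacent_sets_def adj_def pairwise_def)
  then show ?thesis
    using M(1) finite_clique_minor_sizes(1) unfolding hadwiger_number_def by (intro Max_ge) auto
qed

section \<open>Arc count of a Kempe-coloring and the conclusion\<close>

text \<open>The inequality \<open>pair\<close> is summed over all ordered pairs of distinct classes.
  Each vertex is then counted \<open>2 * (card C - 1)\<close> times, each arc at most once, and the
  summand 1 occurs \<open>card C * (card C - 1)\<close> times.\<close>

lemma (in graph) kempe_coloring_card_arcs:
  assumes "kempe_coloring G C"
  shows "2 * (card C - 1) * card (verts G) \<le> card (arcs_ends G) + card C * (card C - 1)"
    and "card C \<le> card (verts G)"
proof -
  let ?R = "arcs_ends G"
  note g = simple_graph_arcs_ends
  have R: "finite ?R" "?R \<subseteq> verts G \<times> verts G" "sym ?R"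
    using g simple_graph_finite[OF g] by (auto simp: simple_graph_def)
  have P: "partition_on (verts G) C" and anti: "\<And>A. A \<in> C \<Longrightarrow> anticlique G A"
    and kc: "\<And>A B. A \<in> C \<Longrightarrow> B \<in> C \<Longrightarrow> A \<noteq> B \<Longrightarrow> conn ?R (A \<union> B)"
    using assms connected_iff_conn[OF R(3)] by (auto simp: kempe_coloring_def coloring_def)
  have finC: "finite C" using P finite_elements finite_verts by blast
  have finA: "finite A" "A \<noteq> {}" if "A \<in> C" for A
    using that P finite_verts by (auto simp: partition_on_def intro: finite_subset)
  have disj: "A \<inter> B = {}" if "A \<in> C" "B \<in> C" "A \<noteq> B" for A B
    using that P by (auto simp: partition_on_def disjoint_def)
  have cardV: "card (verts G) = (\<Sum>A\<in>C. card A)"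
  proof -
    have "card (\<Union>C) = (\<Sum>A\<in>C. card A)"
      using finA disj by (intro card_Union_disjoint) (auto simp: pairwise_def disjnt_def)
    then show ?thesis using P by (simp add: partition_on_def)
  qed
  have "(\<Sum>A\<in>C. 1) \<le> (\<Sum>A\<in>C. card A)"
    using finA by (intro sum_mono) (simp add: Suc_le_eq card_gt_0_iff)
  then show "card C \<le> card (verts G)" using cardV by simp

  \<comment> \<open>Since \<open>A\<close> and \<open>B\<close> are anticliques, all arcs within
    \<open>A \<union> B\<close> run between them, half in each direction.\<close>
  have pair: "card A + card B \<le> card (?R \<inter> A \<times> B) + 1"
    if AB: "A \<in> C" "B \<in> C" "A \<noteq> B" for A B
  proof -
    have na: "?R \<inter> A \<times> A = {}" if "A \<in> C" for A
      using anti[OF that] adj_not_same unfolding anticlique_def pairwise_def by fast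
    have "?R \<inter> B \<times> A = prod.swap ` (?R \<inter> A \<times> B)"
      using R(3) by (force simp: sym_def)
    then have sw: "card (?R \<inter> B \<times> A) = card (?R \<inter> A \<times> B)"
      by (simp add: card_image)
    have "?R \<inter> (A \<union> B) \<times> (A \<union> B) = ?R \<inter> A \<times> B \<union> ?R \<inter> B \<times> A"
      using na[OF AB(1)] na[OF AB(2)] by auto
    then have "card (?R \<inter> (A \<union> B) \<times> (A \<union> B)) \<le> 2 * card (?R \<inter> A \<times> B)"
      using card_Un_le[of "?R \<inter> A \<times> B" "?R \<inter> B \<times> A"] sw by simp
    moreover have "2 * card (A \<union> B) \<le> card (?R \<inter> (A \<union> B) \<times> (A \<union> B)) + 2"
      using conn_card_bound[OF _ kc[OF AB] R(3)] finA(1) AB by simp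
    moreover have "card (A \<union> B) = card A + card B"
      using finA disj AB by (intro card_Un_disjoint) auto
    ultimately show ?thesis by simp
  qed
  let ?I = "Sigma C (\<lambda>A. C - {A})"
  have finI: "finite ?I" using finC by simp
  have "(\<Sum>(A, B)\<in>?I. card (?R \<inter> A \<times> B)) = card (\<Union>(A, B)\<in>?I. ?R \<inter> A \<times> B)"
  proof (subst card_UN_disjoint)
    have "(?R \<inter> A \<times> B) \<inter> (?R \<inter> A' \<times> B') = {}"
      if "A \<in> C" "B \<in> C" "A' \<in> C" "B' \<in> C" "(A, B) \<noteq> (A', B')" for A B A' B'
      using disj[of A A'] disj[of B B'] that by blast
    then show "\<forall>i\<in>?I. \<forall>j\<in>?I. i \<noteq> j \<longrightarrow> (case i of (A, B) \<Rightarrow> ?R \<inter> A \<times> B) \<inter>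
        (case j of (A, B) \<Rightarrow> ?R \<inter> A \<times> B) = {}"
      by (simp add: case_prod_beta prod_eq_iff)
  qed (use finI R(1) in \<open>auto intro: sum.cong\<close>)
  also have "\<dots> \<le> card ?R" using R(1) by (intro card_mono) auto
  finally have le: "(\<Sum>(A, B)\<in>?I. card (?R \<inter> A \<times> B)) \<le> card ?R" .
  have "(\<Sum>(A, B)\<in>?I. card A + card B) \<le> (\<Sum>(A, B)\<in>?I. card (?R \<inter> A \<times> B) + 1)"
    using pair by (intro sum_mono) auto
  also have "\<dots> = (\<Sum>(A, B)\<in>?I. card (?R \<inter> A \<times> B)) + card ?I"
    by (simp add: case_prod_beta sum_Suc)
  also have "card ?I = card C * (card C - 1)"
    using finC by (simp add: card_SigmaI)
  finally have up: "(\<Sum>(A, B)\<in>?I. card A + card B) \<le> card ?R + card C * (card C - 1)"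
    using le by simp
  have I1: "(\<Sum>(A, B)\<in>?I. card A) = (card C - 1) * card (verts G)"
    using finC by (simp add: sum.Sigma[symmetric] cardV sum_distrib_left)
  have "(\<Sum>(A, B)\<in>?I. card B) = (\<Sum>(A, B)\<in>?I. card A)"
    by (rule sum.reindex_bij_witness[of _ prod.swap prod.swap]) auto
  then have "(\<Sum>(A, B)\<in>?I. card A + card B) = 2 * (card C - 1) * card (verts G)"
    using I1 by (simp add: case_prod_beta sum.distrib)
  then show "2 * (card C - 1) * card (verts G) \<le> card ?R + card C * (card C - 1)"
    using up by simp
qed

theorem theorem2:
  fixes G :: "('a, 'b) pre_digraph" and k :: nat
  assumes "graph G" and "k \<le> 6"
    and "\<exists>C. kempe_coloring G C \<and> card C = k"
  shows "hadwiger_number G \<ge> k"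
proof -
  interpret graph G by fact
  note g = simple_graph_arcs_ends
  let ?n = "card (verts G)"
  have n: "k \<le> ?n" and e: "2 * (k - 1) * ?n \<le> card (arcs_ends G) + k * (k - 1)"
    using assms(3) kempe_coloring_card_arcs by blast+
  consider "k = 0" | "k = 1" | "k = 2" | "k = 3" | "k = 4" | "k = 5" | "k = 6"
    using assms(2) by linarith
  \<comment> \<open>For \<open>k = 2, 3, 6\<close> the bound \<open>e\<close> is the hypothesis of
    the minor lemma. For \<open>k = 4\<close> and \<open>k = 5\<close> it implies that hypothesis
    because \<open>k \<le> ?n\<close>: \<open>6 * ?n - 12 \<ge> 4 * ?n - 4\<close> once
    \<open>?n \<ge> 4\<close>, and \<open>8 * ?n - 20 \<ge> 6 * ?n - 10\<close> once
    \<open>?n \<ge> 5\<close>.\<close>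
  then show ?thesis
  proof cases
    case 1
    then show ?thesis by simp
  next
    case 2
    then show ?thesis using hadwiger_number_ge K1_minor[OF g] n by simp
  next
    case 3
    then show ?thesis using hadwiger_number_ge K2_minor[OF g] n e by simp
  next
    case 4
    then show ?thesis using hadwiger_number_ge K3_minor[OF g] n e by simp
  next
    case 5
    then show ?thesis using hadwiger_number_ge K4_minor[OF g] n e by simp
  next
    case 6
    then show ?thesis using hadwiger_number_ge K5_minor[OF g] n e by simp
  next
    case 7
    then show ?thesis using hadwiger_number_ge K6_minor[OF g] n e by simp
  qed
qed

end
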